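(* There exist absolute constants $c_1,c_2>0$ such that the following holds. Let $p$ be a prime and let $A\subseteq\mathbb{Z}_p$ be random, each $a\in\mathbb{Z}_p$ included independently with probability $q=1/\sqrt{p}$. Then, with probability tending to $1$ as $p\to\infty$, \[c_1\log p\le ap(A+A)\le c_2\log p.\]
   Context: $A+A=\{a+b:a,b\in A\}$. For $X\subseteq\mathbb{Z}_p$, $ap(X)$ denotes the maximum length $k$ of an arithmetic progression $b,b+d,\dots,b+(k-1)d$ (with $d\neq 0$) all of whose terms lie in $X$. *)

theory Defs
  imports "HOL-Probability.Probability" "HOL-Computational_Algebra.Primes"
begin

text \<open>
  The residues \<open>\<int>\<^sub>p\<close> are represented by \<open>{..<p}\<close> with arithmetic modulo \<open>p\<close>: the modulus has to
  be a variable of the formula, since the theorem takes a limit in \<open>p\<close>.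
\<close>

definition sumset_mod :: "nat \<Rightarrow> nat set \<Rightarrow> nat set" where
  "sumset_mod p A = {(a + b) mod p | a b. a \<in> A \<and> b \<in> A}"

text \<open>
  The terms of a progression are required to be distinct. For prime \<open>p\<close> and \<open>d \<noteq> 0\<close> this just says
  that the length is at most \<open>p\<close>; without it the maximum would not exist for \<open>X = \<int>\<^sub>p\<close>.
\<close>

definition has_ap_mod :: "nat \<Rightarrow> nat set \<Rightarrow> nat \<Rightarrow> bool" where
  "has_ap_mod p X k \<longleftrightarrow>
     (\<exists>b\<in>{..<p}. \<exists>d\<in>{..<p}. d \<noteq> 0 \<and>
        inj_on (\<lambda>i. (b + i * d) mod p) {..<k} \<and> (\<forall>i<k. (b + i * d) mod p \<in> X))"

definition ap_mod :: "nat \<Rightarrow> nat set \<Rightarrow> nat" where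
  "ap_mod p X = Max {k. has_ap_mod p X k}"

lemma has_ap_mod_le:
  assumes "has_ap_mod p X k"
  shows "k \<le> p"
proof -
  obtain b d where "b < p" and inj: "inj_on (\<lambda>i. (b + i * d) mod p) {..<k}"
    using assms by (auto simp: has_ap_mod_def)
  then have "(\<lambda>i. (b + i * d) mod p) ` {..<k} \<subseteq> {..<p}"
    by auto
  from card_inj_on_le[OF inj this] show ?thesis
    by simp
qed

lemma finite_has_ap_mod: "finite {k. has_ap_mod p X k}"
  by (rule finite_subset[of _ "{..p}"]) (auto dest: has_ap_mod_le)

lemma has_ap_mod_0:
  assumes "p \<ge> 2"
  shows "has_ap_mod p X 0"
  unfolding has_ap_mod_def using assms
  by (intro bexI[of _ "0 :: nat"] bexI[of _ "1 :: nat"]) simp_all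

definition random_subset_pmf :: "nat \<Rightarrow> real \<Rightarrow> nat set pmf" where
  "random_subset_pmf p q =
     map_pmf (\<lambda>f. {a \<in> {..<p}. f a}) (Pi_pmf {..<p} False (\<lambda>_. bernoulli_pmf q))"

end

theory Submission imports Defs "HOL-Real_Asymp.Real_Asymp" begin

text \<open>
  Upper bound. A first moment computation shows that with high probability \<open>A\<close> meets every progression
  of length \<open>k = O(log p)\<close> in at most four points. If a progression \<open>P\<close> of length \<open>k\<close> lies in \<open>A + A\<close>,
  then at least \<open>2 (k - 4)\<close> ordered pairs of distinct elements of \<open>A\<close> have their sum in \<open>P\<close>, and each
  element of \<open>A\<close> is in at most eight of them. Picking pairs greedily gives at least \<open>(3 k / 2)\<^sup>s\<close>
  sequences of \<open>s = k div 64\<close> vertex-disjoint pairs, whereas the expected number of such sequences is at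
  most \<open>(p k q\<^sup>2)\<^sup>s = k\<^sup>s\<close>. By Markov's inequality this has probability at most \<open>(2/3)\<^sup>s\<close>, which beats
  the number \<open>p\<^sup>2\<close> of progressions.

  Lower bound. Let \<open>M = m k\<close> with \<open>m\<close> about \<open>p\<close> to the power \<open>1/8\<close>, and first reveal
  \<open>B = A \<inter> [M, p/2)\<close>. With high probability \<open>B\<close> has at least \<open>c \<surd>p\<close> elements at distance at least \<open>M\<close>
  from the rest of \<open>B\<close>. For these \<open>b\<close> the sets \<open>x - B\<close>, \<open>x < M\<close>, are disjoint subsets of the upper half
  of the residues, so the events \<open>x \<in> B + A\<close> are independent, each of probability bounded below by a
  constant \<open>\<gamma>\<close>. Each of the \<open>m\<close> blocks of \<open>k\<close> consecutive residues is then covered independently with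
  probability at least \<open>\<gamma>\<^sup>k\<close>, and \<open>m \<gamma>\<^sup>k\<close> tends to infinity if \<open>k\<close> is a small multiple of \<open>log p\<close>.
\<close>

section \<open>Random subsets\<close>

text \<open>A union bound whose covering condition is checked on the support only. For random
  subsets this makes \<open>A \<subseteq> {..<p}\<close> available.\<close>

lemma prob_le_sum_prob:
  assumes "finite I" and "\<And>A. A \<in> set_pmf M \<Longrightarrow> A \<in> E \<Longrightarrow> \<exists>i\<in>I. A \<in> F i"
  shows "measure_pmf.prob M E \<le> (\<Sum>i\<in>I. measure_pmf.prob M (F i))"
proof -
  have "measure_pmf.prob M E = measure_pmf.prob M (E \<inter> set_pmf M)"
    by (simp add: measure_Int_set_pmf)
  also have "\<dots> \<le> measure_pmf.prob M (\<Union>i\<in>I. F i)"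
    using assms(2) by (intro measure_pmf.finite_measure_mono) auto
  also have "\<dots> \<le> (\<Sum>i\<in>I. measure_pmf.prob M (F i))"
    by (rule measure_pmf.finite_measure_subadditive_finite) (use assms in auto)
  finally show ?thesis .
qed

text \<open>Markov's inequality for the number of events \<open>F i\<close> that occur; its
  expectation is the sum of their probabilities by linearity.\<close>

lemma prob_card_ge_le:
  fixes t :: real
  assumes "finite I" and "t > 0"
  shows "measure_pmf.prob M {A. t \<le> real (card {i\<in>I. A \<in> F i})}
         \<le> (\<Sum>i\<in>I. measure_pmf.prob M (F i)) / t"
proof -
  have card: "real (card {i\<in>I. A \<in> F i}) = (\<Sum>i\<in>I. indicat_real (F i) A)" for A
    using assms(1) by (simp add: indicator_def sum.If_cases Int_def)
  have int: "integrable (measure_pmf M) (\<lambda>A. \<Sum>i\<in>I. indicat_real (F i) A)"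
    by (intro Bochner_Integration.integrable_sum) (simp add: measure_pmf.emeasure_eq_measure)
  have "measure_pmf.prob M {A. t \<le> real (card {i\<in>I. A \<in> F i})}
        \<le> measure_pmf.expectation M (\<lambda>A. \<Sum>i\<in>I. indicat_real (F i) A) / t"
    unfolding card
    using int integral_Markov_inequality_measure[of "measure_pmf M" "\<lambda>A. \<Sum>i\<in>I. indicat_real (F i) A" "{}" t]
      assms by (auto simp: sum_nonneg)
  also have "measure_pmf.expectation M (\<lambda>A. \<Sum>i\<in>I. indicat_real (F i) A)
             = (\<Sum>i\<in>I. measure_pmf.prob M (F i))"
    by (subst Bochner_Integration.integral_sum) (auto simp: measure_pmf.emeasure_eq_measure)
  finally show ?thesis .
qed

lemma prob_random_subset_superset:
  assumes "V \<subseteq> {..<p}" "0 \<le> q" "q \<le> 1"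
  shows "measure_pmf.prob (random_subset_pmf p q) {A. V \<subseteq> A} = q ^ card V"
proof -
  have "measure_pmf.prob (random_subset_pmf p q) {A. V \<subseteq> A}
        = measure_pmf.prob (Pi_pmf {..<p} False (\<lambda>_. bernoulli_pmf q))
            (Pi {..<p} (\<lambda>a. if a \<in> V then {True} else UNIV))"
    unfolding random_subset_pmf_def measure_map_pmf
    using assms(1) by (intro arg_cong2[where f = measure]) (auto simp: Pi_def split: if_splits)
  also have "\<dots> = (\<Prod>a<p. if a \<in> V then q else 1)"
    using assms by (subst measure_Pi_pmf_Pi) (auto intro!: prod.cong simp: measure_pmf_single)
  also have "\<dots> = q ^ card V"
    using assms(1) by (simp add: prod.If_cases Int_absorb1)
  finally show ?thesis .
qed

lemma prob_random_subset_disjoint: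
  assumes "V \<subseteq> {..<p}" "0 \<le> q" "q \<le> 1"
  shows "measure_pmf.prob (random_subset_pmf p q) {A. A \<inter> V = {}} = (1 - q) ^ card V"
proof -
  have "measure_pmf.prob (random_subset_pmf p q) {A. A \<inter> V = {}}
        = measure_pmf.prob (Pi_pmf {..<p} False (\<lambda>_. bernoulli_pmf q))
            (Pi {..<p} (\<lambda>a. if a \<in> V then {False} else UNIV))"
    unfolding random_subset_pmf_def measure_map_pmf
    using assms(1) by (intro arg_cong2[where f = measure]) (auto simp: Pi_def split: if_splits)
  also have "\<dots> = (\<Prod>a<p. if a \<in> V then 1 - q else 1)"
    using assms by (subst measure_Pi_pmf_Pi) (auto intro!: prod.cong simp: measure_pmf_single)
  also have "\<dots> = (1 - q) ^ card V"
    using assms(1) by (simp add: prod.If_cases Int_absorb1)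
  finally show ?thesis .
qed

section \<open>Independence over disjoint sets of residues\<close>

text \<open>The product rule applied here asks for countable sets; cutting down to the countable
  supports changes no probability.\<close>

lemma measure_pair_pmf_Times:
  "measure_pmf.prob (pair_pmf M N) (X \<times> Y) = measure_pmf.prob M X * measure_pmf.prob N Y"
proof -
  have "measure_pmf.prob (pair_pmf M N) (X \<times> Y)
        = measure_pmf.prob (pair_pmf M N) ((X \<times> Y) \<inter> set_pmf (pair_pmf M N))"
    by (simp only: measure_Int_set_pmf)
  also have "(X \<times> Y) \<inter> set_pmf (pair_pmf M N) = (X \<inter> set_pmf M) \<times> (Y \<inter> set_pmf N)"
    by auto
  also have "measure_pmf.prob (pair_pmf M N) \<dots> = measure_pmf.prob M X * measure_pmf.prob N Y"
    by (subst measure_pmf_prob_product) (auto simp: measure_Int_set_pmf)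
  finally show ?thesis .
qed

text \<open>The indicator function of the random set splits into independent parts on
  \<open>S\<close> and on its complement, and \<open>T\<close> lies in the complement.\<close>

lemma prob_random_subset_indep2:
  assumes "S \<subseteq> {..<p}" "T \<subseteq> {..<p}" "S \<inter> T = {}"
  shows "measure_pmf.prob (random_subset_pmf p q) {A. E (A \<inter> S) \<and> F (A \<inter> T)}
         = measure_pmf.prob (random_subset_pmf p q) {A. E (A \<inter> S)}
           * measure_pmf.prob (random_subset_pmf p q) {A. F (A \<inter> T)}"
proof -
  define R where "R = (\<lambda>V. Pi_pmf V False (\<lambda>_ :: nat. bernoulli_pmf q))"
  have fin: "finite S"
    using assms(1) finite_subset by blast
  have U: "R {..<p} = map_pmf (\<lambda>(f, g) x. if x \<in> S then f x else g x) (pair_pmf (R S) (R ({..<p} - S)))"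
    using Pi_pmf_union[of S "{..<p} - S" False "\<lambda>_. bernoulli_pmf q"] assms(1) fin
    by (simp add: R_def Un_absorb1)
  have R: "random_subset_pmf p q = map_pmf (\<lambda>f. {a \<in> {..<p}. f a}) (R {..<p})"
    by (simp add: random_subset_pmf_def R_def)
  \<comment> \<open>Stated for all \<open>E\<close> and \<open>F\<close>: the instances where one of
    them is constantly true give the two marginals.\<close>
  have *: "measure_pmf.prob (random_subset_pmf p q) {A. E (A \<inter> S) \<and> F (A \<inter> T)}
         = measure_pmf.prob (R S) {f. E {a\<in>S. f a}} * measure_pmf.prob (R ({..<p} - S)) {g. F {a\<in>T. g a}}"
    for E F
  proof -
    have S: "{a. a < p \<and> (a \<in> S \<longrightarrow> f a) \<and> (a \<notin> S \<longrightarrow> g a)} \<inter> S = {a\<in>S. f a}"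
      and T: "{a. a < p \<and> (a \<in> S \<longrightarrow> f a) \<and> (a \<notin> S \<longrightarrow> g a)} \<inter> T = {a\<in>T. g a}" for f g
      using assms by auto
    have "measure_pmf.prob (random_subset_pmf p q) {A. E (A \<inter> S) \<and> F (A \<inter> T)}
          = measure_pmf.prob (pair_pmf (R S) (R ({..<p} - S)))
              ({f. E {a\<in>S. f a}} \<times> {g. F {a\<in>T. g a}})"
      unfolding R U measure_map_pmf
      by (intro arg_cong2[where f = measure]) (auto simp: S T)
    also have "\<dots> = measure_pmf.prob (R S) {f. E {a\<in>S. f a}}
                     * measure_pmf.prob (R ({..<p} - S)) {g. F {a\<in>T. g a}}"
      by (rule measure_pair_pmf_Times)
    finally show ?thesis .
  qed
  show ?thesis
    using *[of E F] *[of E "\<lambda>_. True"] *[of "\<lambda>_. True" F] by simp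
qed

lemma prob_random_subset_indep:
  assumes "finite J" "disjoint_family_on S J" "\<And>j. j \<in> J \<Longrightarrow> S j \<subseteq> {..<p}"
  shows "measure_pmf.prob (random_subset_pmf p q) {A. \<forall>j\<in>J. E j (A \<inter> S j)}
         = (\<Prod>j\<in>J. measure_pmf.prob (random_subset_pmf p q) {A. E j (A \<inter> S j)})"
  using assms
proof (induction J rule: finite_induct)
  case empty
  then show ?case by simp
next
  case (insert j J)
  define T where "T = (\<Union>i\<in>J. S i)"
  have "S j \<inter> T = {}"
    using insert.prems(1) insert.hyps(2) by (auto simp: T_def disjoint_family_on_def)
  \<comment> \<open>Hence the conjunction over \<open>J\<close> is an event about
    \<open>A \<inter> T\<close> alone, and the case of two sets applies.\<close>
  moreover have "A \<inter> T \<inter> S i = A \<inter> S i" if "i \<in> J" for A i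
    using that by (auto simp: T_def)
  moreover have "S j \<subseteq> {..<p}" "T \<subseteq> {..<p}"
    using insert.prems(2) by (auto simp: T_def)
  ultimately have "measure_pmf.prob (random_subset_pmf p q) {A. E j (A \<inter> S j) \<and> (\<forall>i\<in>J. E i (A \<inter> S i))}
        = measure_pmf.prob (random_subset_pmf p q) {A. E j (A \<inter> S j)}
          * measure_pmf.prob (random_subset_pmf p q) {A. \<forall>i\<in>J. E i (A \<inter> S i)}"
    using prob_random_subset_indep2[of "S j" p T q "E j" "\<lambda>B. \<forall>i\<in>J. E i (B \<inter> S i)"] by simp
  moreover have "measure_pmf.prob (random_subset_pmf p q) {A. \<forall>i\<in>J. E i (A \<inter> S i)}
                 = (\<Prod>i\<in>J. measure_pmf.prob (random_subset_pmf p q) {A. E i (A \<inter> S i)})"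
    using insert.prems by (intro insert.IH) (auto simp: disjoint_family_on_def)
  ultimately show ?case
    using insert.hyps by simp
qed

text \<open>Disjointness makes the events independent, and each \<open>W x\<close> is missed with
  probability at most \<open>(1 - q) ^ n\<close>.\<close>

lemma prob_random_subset_hits_all_ge:
  assumes "finite X" "disjoint_family_on W X" "\<And>x. x \<in> X \<Longrightarrow> W x \<subseteq> {..<p}"
    and "\<And>x. x \<in> X \<Longrightarrow> card (W x) \<ge> n" "0 \<le> q" "q \<le> 1"
  shows "measure_pmf.prob (random_subset_pmf p q) {A. \<forall>x\<in>X. A \<inter> W x \<noteq> {}} \<ge> (1 - (1 - q) ^ n) ^ card X"
proof -
  have "(1 - (1 - q) ^ n) ^ card X = (\<Prod>x\<in>X. 1 - (1 - q) ^ n)"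
    by simp
  also have "\<dots> \<le> (\<Prod>x\<in>X. measure_pmf.prob (random_subset_pmf p q) {A. A \<inter> W x \<noteq> {}})"
  proof (intro prod_mono conjI)
    fix x assume x: "x \<in> X"
    show "0 \<le> 1 - (1 - q) ^ n"
      using assms(5,6) by (simp add: power_le_one)
    have "measure_pmf.prob (random_subset_pmf p q) {A. A \<inter> W x \<noteq> {}} = 1 - (1 - q) ^ card (W x)"
      using measure_pmf.prob_compl[of "{A. A \<inter> W x = {}}" "random_subset_pmf p q"]
        prob_random_subset_disjoint[OF assms(3)[OF x] assms(5,6)]
      by (simp add: set_diff_eq)
    moreover have "(1 - q) ^ card (W x) \<le> (1 - q) ^ n"
      using assms(4)[OF x] assms(5,6) by (intro power_decreasing) auto
    ultimately show "1 - (1 - q) ^ n \<le> measure_pmf.prob (random_subset_pmf p q) {A. A \<inter> W x \<noteq> {}}"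
      by simp
  qed
  also have "\<dots> = measure_pmf.prob (random_subset_pmf p q) {A. \<forall>x\<in>X. A \<inter> W x \<noteq> {}}"
    using prob_random_subset_indep[OF assms(1-3), where E = "\<lambda>_ B. B \<noteq> {}"] by simp
  finally show ?thesis .
qed

text \<open>A Chernoff bound for the lower tail: Markov's inequality for 2 to the power
  \<open>- card (A \<inter> L)\<close>. This variable is a product of independent factors, each of
  mean \<open>1 - q / 2\<close> on \<open>L\<close>.\<close>

lemma prob_card_random_subset_le:
  assumes "L \<subseteq> {..<p}" "0 \<le> q" "q \<le> 1"
  shows "measure_pmf.prob (random_subset_pmf p q) {A. real (card (A \<inter> L)) \<le> t}
         \<le> 2 powr t * exp (- q * real (card L) / 2)"
proof -
  define M where "M = Pi_pmf {..<p} False (\<lambda>_. bernoulli_pmf q)"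
  define Z where "Z = (\<lambda>f :: nat \<Rightarrow> bool. \<Prod>a<p. if a \<in> L \<and> f a then 1 / 2 else 1 :: real)"
  have Z: "Z f = 2 powr - real (card ({a \<in> {..<p}. f a} \<inter> L))" for f
  proof -
    have "{..<p} \<inter> {a. a \<in> L \<and> f a} = {a \<in> {..<p}. f a} \<inter> L"
      by auto
    then show ?thesis
      by (simp add: Z_def prod.If_cases powr_minus powr_realpow power_one_over field_simps)
  qed
  have Z_nonneg: "Z f \<ge> 0" for f
    by (simp add: Z)
  have "measure_pmf.prob (random_subset_pmf p q) {A. real (card (A \<inter> L)) \<le> t}
        = measure_pmf.prob M {f. Z f \<ge> 2 powr - t}"
    unfolding random_subset_pmf_def M_def measure_map_pmf Z
    by (intro arg_cong2[where f = measure]) auto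
  also have "\<dots> \<le> measure_pmf.expectation M Z / 2 powr - t"
  proof -
    have "integrable (measure_pmf M) Z"
      by (rule measure_pmf.integrable_const_bound[where B = 1])
         (auto simp: Z powr_minus powr_realpow field_simps)
    then show ?thesis
      using integral_Markov_inequality_measure[of "measure_pmf M" Z "{}" "2 powr - t"]
      by (auto simp: Z_nonneg)
  qed
  also have "measure_pmf.expectation M Z
             = (\<Prod>a<p. measure_pmf.expectation (bernoulli_pmf q) (\<lambda>v. if a \<in> L \<and> v then 1 / 2 else 1))"
    unfolding M_def Z_def
    by (rule expectation_prod_Pi_pmf) (auto intro!: integrable_measure_pmf_finite)
  also have "\<dots> = (\<Prod>a<p. if a \<in> L then 1 - q / 2 else 1)"
    using assms by (intro prod.cong) (auto simp: field_simps)
  also have "\<dots> = (1 - q / 2) ^ card L"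
    using assms by (simp add: prod.If_cases Int_absorb1)
  also have "\<dots> \<le> exp (- q / 2) ^ card L"
    using exp_ge_add_one_self[of "- q / 2"] assms by (intro power_mono) auto
  also have "\<dots> = exp (- q * real (card L) / 2)"
    by (simp flip: exp_of_nat_mult add: field_simps)
  finally show ?thesis
    by (simp add: powr_minus field_simps divide_right_mono)
qed

section \<open>The upper bound\<close>

lemma random_subset_pmf_subset:
  assumes "A \<in> set_pmf (random_subset_pmf p q)"
  shows "A \<subseteq> {..<p}"
  using assms by (auto simp: random_subset_pmf_def)

section \<open>Elementary facts on progressions modulo \<open>p\<close>\<close>

lemma has_ap_mod_antimono:
  assumes "has_ap_mod p X k" "j \<le> k"
  shows "has_ap_mod p X j"
proof -
  have "{..<j} \<subseteq> {..<k}"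
    using assms(2) by auto
  then show ?thesis
    using assms unfolding has_ap_mod_def by (meson inj_on_subset order_less_le_trans)
qed

lemma ap_mod_ge:
  assumes "has_ap_mod p X k"
  shows "k \<le> ap_mod p X"
  unfolding ap_mod_def using assms by (intro Max_ge finite_has_ap_mod) auto

text \<open>The possible lengths are closed downwards, and \<open>p \<ge> 2\<close> makes the set of
  lengths nonempty, so that its \<open>Max\<close> is attained.\<close>

lemma ap_mod_less:
  assumes "\<not> has_ap_mod p X k" "p \<ge> 2"
  shows "ap_mod p X < k"
proof -
  have "ap_mod p X \<in> {k. has_ap_mod p X k}"
    unfolding ap_mod_def using has_ap_mod_0[OF assms(2)] by (intro Max_in finite_has_ap_mod) auto
  then show ?thesis
    using assms(1) has_ap_mod_antimono by (metis mem_Collect_eq not_less)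
qed

lemma inj_on_ap_mod:
  fixes p :: nat
  assumes "prime p" "0 < d" "d < p" "k \<le> p"
  shows "inj_on (\<lambda>i. (b + i * d) mod p) {..<k}"
proof -
  have neq: "(b + i * d) mod p \<noteq> (b + j * d) mod p" if ij: "i < j" "j < k" for i j
  proof -
    have "b + j * d - (b + i * d) = (j - i) * d"
      by (simp add: diff_mult_distrib)
    moreover have "\<not> p dvd (j - i)" "\<not> p dvd d"
      using ij assms by (auto dest!: dvd_imp_le)
    ultimately have "\<not> p dvd b + j * d - (b + i * d)"
      using assms(1) by (simp add: prime_dvd_mult_iff)
    then show ?thesis
      using mod_eq_dvd_iff_nat[of "b + i * d" "b + j * d" p] ij by auto
  qed
  show ?thesis
    by (rule inj_onI) (metis neq lessThan_iff linorder_neqE_nat)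
qed

section \<open>Few random points on a progression\<close>

text \<open>Why 4: for \<open>q = 1 / sqrt p\<close>, five points on a progression cost
  \<open>q ^ 5\<close>, which beats the fewer than \<open>p ^ 2\<close> choices of \<open>b\<close>
  and \<open>d\<close> up to a power of \<open>k\<close>. Four points would only balance
  them.\<close>

definition sparse_on_aps :: "nat \<Rightarrow> nat \<Rightarrow> nat set \<Rightarrow> bool" where
  "sparse_on_aps p k A \<longleftrightarrow>
     (\<forall>b\<in>{..<p}. \<forall>d\<in>{1..<p}. card {i\<in>{..<k}. (b + i * d) mod p \<in> A} \<le> 4)"

lemma prob_not_sparse_on_aps_le:
  assumes "prime p" "k \<le> p" "0 \<le> q" "q \<le> 1"
  shows "measure_pmf.prob (random_subset_pmf p q) {A. \<not> sparse_on_aps p k A}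
         \<le> real p ^ 2 * real k ^ 5 * q ^ 5"
proof -
  define \<I> where "\<I> = {I. I \<subseteq> {..<k} \<and> card I = 5}"
  define J where "J = {..<p} \<times> {1..<p} \<times> \<I>"
  have fin: "finite J"
    by (auto simp: J_def \<I>_def)
  have "measure_pmf.prob (random_subset_pmf p q) {A. \<not> sparse_on_aps p k A}
        \<le> (\<Sum>(b, d, I)\<in>J. measure_pmf.prob (random_subset_pmf p q)
             {A. (\<lambda>i. (b + i * d) mod p) ` I \<subseteq> A})"
    unfolding case_prod_unfold
  proof (rule prob_le_sum_prob[OF fin])
    fix A assume "A \<in> {A. \<not> sparse_on_aps p k A}"
    then obtain b d where bd: "b < p" "d \<in> {1..<p}"
      "5 \<le> card {i\<in>{..<k}. (b + i * d) mod p \<in> A}"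
      by (force simp: sparse_on_aps_def not_le)
    from obtain_subset_with_card_n[OF bd(3)] obtain I
      where "I \<subseteq> {i\<in>{..<k}. (b + i * d) mod p \<in> A}" "card I = 5" .
    then show "\<exists>z\<in>J. A \<in> {A. (\<lambda>i. (fst z + i * fst (snd z)) mod p) ` snd (snd z) \<subseteq> A}"
      using bd by (intro bexI[of _ "(b, d, I)"]) (auto simp: J_def \<I>_def)
  qed
  also have "\<dots> = (\<Sum>_\<in>J. q ^ 5)"
  proof (rule sum.cong, goal_cases)
    case (2 z)
    obtain b d I where z: "z = (b, d, I)" and I: "d \<in> {1..<p}" "I \<subseteq> {..<k}" "card I = 5"
      using 2 by (auto simp: J_def \<I>_def)
    \<comment> \<open>As \<open>k \<le> p\<close>, five indices give five distinct residues, so the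
      probability is exactly \<open>q ^ 5\<close>.\<close>
    have "inj_on (\<lambda>i. (b + i * d) mod p) I"
      by (rule inj_on_subset[OF inj_on_ap_mod[of p d k b]]) (use I assms in auto)
    then have "card ((\<lambda>i. (b + i * d) mod p) ` I) = 5"
      using I(3) by (simp add: card_image)
    moreover have "(\<lambda>i. (b + i * d) mod p) ` I \<subseteq> {..<p}"
      using I(1) by auto
    ultimately show ?case
      using prob_random_subset_superset[OF _ assms(3,4)] by (simp add: z)
  qed simp
  also have "\<dots> = real (card J) * q ^ 5"
    by simp
  also have "\<dots> \<le> real (p * p * k ^ 5) * q ^ 5"
  proof -
    have "card \<I> = k choose 5"
      unfolding \<I>_def using n_subsets[of "{..<k}" 5] by simp
    also have "\<dots> \<le> k ^ 5"
      by (cases "5 \<le> k") (auto simp: binomial_le_pow binomial_eq_0)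
    finally have "card J \<le> p * (p * k ^ 5)"
      unfolding J_def card_cartesian_product by (intro mult_mono) auto
    then show ?thesis
      using assms(3) by (intro mult_right_mono) (auto simp: mult.assoc simp del: of_nat_mult)
  qed
  finally show ?thesis
    by (simp add: power2_eq_square)
qed

text \<open>
  Pairs are ordered, so a progression of length \<open>k\<close> contributes \<open>2 k\<close> pairs if it is covered by the
  sumset, while the expected number of pairs is only \<open>k\<close>.
\<close>

definition sum_pairs :: "nat \<Rightarrow> nat set \<Rightarrow> nat set \<Rightarrow> (nat \<times> nat) set" where
  "sum_pairs p P A = {(a, b). a \<in> A \<and> b \<in> A \<and> a \<noteq> b \<and> (a + b) mod p \<in> P}"

text \<open>All \<open>2 * s\<close> entries are distinct, so a fixed sequence of pairs lies in the
  random set with probability \<open>q ^ (2 * s)\<close>. Lists are used so that the greedy choice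
  multiplies the counts without dividing by orderings.\<close>

definition disjoint_sum_pairs :: "nat \<Rightarrow> nat set \<Rightarrow> nat set \<Rightarrow> nat \<Rightarrow> (nat \<times> nat) list set" where
  "disjoint_sum_pairs p P A s =
     {xs. length xs = s \<and> set xs \<subseteq> sum_pairs p P A \<and> distinct (map fst xs @ map snd xs)}"

lemma finite_sum_pairs [intro]: "finite A \<Longrightarrow> finite (sum_pairs p P A)"
  by (rule finite_subset[of _ "A \<times> A"]) (auto simp: sum_pairs_def)

lemma disjoint_sum_pairs_subset_lists:
  "disjoint_sum_pairs p P A s \<subseteq> {xs. set xs \<subseteq> sum_pairs p P A \<and> length xs = s}"
  by (auto simp: disjoint_sum_pairs_def)

lemma finite_disjoint_sum_pairs [intro]:
  assumes "finite A"
  shows "finite (disjoint_sum_pairs p P A s)"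
  by (rule finite_subset[OF disjoint_sum_pairs_subset_lists finite_lists_length_eq])
     (use assms in auto)

section \<open>Counting pairs and sequences of disjoint pairs\<close>

text \<open>A pair is determined by its first entry and its sum modulo \<open>p\<close>.\<close>

lemma card_sum_pairs_le:
  assumes "finite P"
  shows "card (sum_pairs p P {..<p}) \<le> p * card P"
proof -
  have inv: "((a + b) mod p + (p - a)) mod p = b" if "a < p" "b < p" for a b
    unfolding mod_add_left_eq using that by simp
  have "inj_on (\<lambda>(a, b). (a, (a + b) mod p)) (sum_pairs p P {..<p})"
    by (rule inj_on_inverseI[where g = "\<lambda>(a, x). (a, (x + (p - a)) mod p)"])
       (use inv in \<open>force simp: sum_pairs_def simp del: Nat.diff_add_assoc Nat.add_diff_assoc\<close>)
  moreover have "(\<lambda>(a, b). (a, (a + b) mod p)) ` sum_pairs p P {..<p} \<subseteq> {..<p} \<times> P"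
    by (auto simp: sum_pairs_def)
  ultimately show ?thesis
    using card_inj_on_le[of _ "sum_pairs p P {..<p}" "{..<p} \<times> P"] assms by auto
qed

text \<open>Fix one representation \<open>f x + g x\<close> of every \<open>x\<close> in
  \<open>P\<close>. Those with equal summands inject into the at most \<open>D\<close> elements
  whose double is in \<open>P\<close>; each of the others yields two ordered pairs.\<close>

lemma card_sum_pairs_ge:
  assumes "P \<subseteq> sumset_mod p A" "finite A" "card {a\<in>A. (a + a) mod p \<in> P} \<le> D"
  shows "2 * (card P - D) \<le> card (sum_pairs p P A)"
proof -
  have "\<forall>x\<in>P. \<exists>a b. a \<in> A \<and> b \<in> A \<and> (a + b) mod p = x"
    using assms(1) unfolding sumset_mod_def by blast
  then obtain f g where fg: "\<And>x. x \<in> P \<Longrightarrow> f x \<in> A \<and> g x \<in> A \<and> (f x + g x) mod p = x"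
    by metis
  define Q where "Q = {x\<in>P. f x \<noteq> g x}"
  have finP: "finite P"
    by (rule finite_subset[OF assms(1)], rule finite_subset[of _ "(\<lambda>(a, b). (a + b) mod p) ` (A \<times> A)"])
       (use assms(2) in \<open>auto simp: sumset_mod_def\<close>)
  have "card (P - Q) \<le> card {a\<in>A. (a + a) mod p \<in> P}"
  proof (rule card_inj_on_le[where f = f])
    show "inj_on f (P - Q)"
      by (rule inj_on_inverseI[where g = "\<lambda>a. (a + a) mod p"]) (use fg in \<open>fastforce simp: Q_def\<close>)
    show "f ` (P - Q) \<subseteq> {a\<in>A. (a + a) mod p \<in> P}"
      using fg by (force simp: Q_def)
  qed (use assms(2) in auto)
  then have "card P - D \<le> card Q"
    using assms(3) card_Diff_subset[of Q P] finP by (auto simp: Q_def)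
  \<comment> \<open>A pair recovers \<open>x\<close> as its sum, so the two maps are injective; a
    common value of both would force \<open>f x = g x\<close>.\<close>
  moreover have "2 * card Q = card ((\<lambda>x. (f x, g x)) ` Q \<union> (\<lambda>x. (g x, f x)) ` Q)"
  proof (subst card_Un_disjoint)
    show "(\<lambda>x. (f x, g x)) ` Q \<inter> (\<lambda>x. (g x, f x)) ` Q = {}"
    proof (rule ccontr)
      assume "\<not> ?thesis"
      then obtain x y where "x \<in> Q" "y \<in> Q" "f x = g y" "g x = f y"
        by auto
      moreover from this have "x = y"
        using fg by (metis (no_types, lifting) Q_def add.commute mem_Collect_eq)
      ultimately show False
        by (simp add: Q_def)
    qed
    have "inj_on (\<lambda>x. (f x, g x)) Q" "inj_on (\<lambda>x. (g x, f x)) Q"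
      by (rule inj_on_inverseI[where g = "\<lambda>(a, b). (a + b) mod p"],
          use fg in \<open>simp add: Q_def add.commute\<close>)+
    then show "2 * card Q = card ((\<lambda>x. (f x, g x)) ` Q) + card ((\<lambda>x. (g x, f x)) ` Q)"
      by (simp add: card_image)
  qed (use finP in \<open>auto simp: Q_def\<close>)
  moreover have "\<dots> \<le> card (sum_pairs p P A)"
    using fg assms(2) by (intro card_mono finite_sum_pairs) (auto simp: sum_pairs_def Q_def add.commute)
  ultimately show ?thesis
    by linarith
qed

text \<open>Greedy choice: fewer than \<open>t\<close> earlier pairs occupy at most
  \<open>2 * t\<close> elements, each in at most \<open>2 * D\<close> ordered pairs, so every step
  has at least \<open>card (sum_pairs p P A) - 4 * D * t\<close> choices. Fixing \<open>t\<close> in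
  the induction on \<open>s\<close> keeps the base of the power constant.\<close>

lemma card_disjoint_sum_pairs_ge:
  assumes "finite A" and deg: "\<And>v. v \<in> A \<Longrightarrow> card {w\<in>A. (v + w) mod p \<in> P} \<le> D"
    and "s \<le> t"
  shows "(card (sum_pairs p P A) - 4 * D * t) ^ s \<le> card (disjoint_sum_pairs p P A s)"
  using \<open>s \<le> t\<close>
proof (induction s)
  case 0
  have "disjoint_sum_pairs p P A 0 = {[]}"
    by (auto simp: disjoint_sum_pairs_def)
  then show ?case by simp
next
  case (Suc s)
  define N where "N = card (sum_pairs p P A) - 4 * D * t"
  define V where "V = (\<lambda>xs :: (nat \<times> nat) list. fst ` set xs \<union> snd ` set xs)"
  define G where "G = (\<lambda>xs. {e \<in> sum_pairs p P A. fst e \<notin> V xs \<and> snd e \<notin> V xs})"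
  have G: "N \<le> card (G xs)" if xs: "xs \<in> disjoint_sum_pairs p P A s" for xs
  proof -
    \<comment> \<open>The pairs through \<open>v\<close>, with \<open>v\<close> as first or as
      second entry.\<close>
    define H where "H = (\<lambda>v. Pair v ` {w\<in>A. (v + w) mod p \<in> P} \<union> (\<lambda>w. (w, v)) ` {w\<in>A. (v + w) mod p \<in> P})"
    have V: "V xs \<subseteq> A" "finite (V xs)"
      using xs by (auto simp: V_def disjoint_sum_pairs_def sum_pairs_def)
    have "card (V xs) \<le> s + s"
      unfolding V_def using xs
      by (intro order.trans[OF card_Un_le] add_mono order.trans[OF card_image_le] order.trans[OF card_length])
         (auto simp: disjoint_sum_pairs_def)
    have "card (\<Union>v\<in>V xs. H v) \<le> (\<Sum>v\<in>V xs. card (H v))"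
      by (rule card_UN_le) (rule V)
    also have "\<dots> \<le> (\<Sum>v\<in>V xs. D + D)"
    proof (rule sum_mono)
      fix v assume "v \<in> V xs"
      then have "card {w\<in>A. (v + w) mod p \<in> P} \<le> D"
        using deg V(1) by blast
      then show "card (H v) \<le> D + D"
        unfolding H_def using assms(1)
        by (intro order.trans[OF card_Un_le] add_mono order.trans[OF card_image_le]) auto
    qed
    also have "\<dots> = card (V xs) * (D + D)"
      by simp
    also have "\<dots> \<le> (2 * t) * (D + D)"
      using \<open>card (V xs) \<le> s + s\<close> Suc.prems by (intro mult_right_mono) auto
    also have "\<dots> = 4 * D * t"
      by simp
    finally have "card (\<Union>v\<in>V xs. H v) \<le> 4 * D * t" .
    moreover have "sum_pairs p P A \<subseteq> G xs \<union> (\<Union>v\<in>V xs. H v)"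
      by (auto simp: G_def H_def sum_pairs_def add.commute)
    then have "card (sum_pairs p P A) \<le> card (G xs) + card (\<Union>v\<in>V xs. H v)"
      using assms(1) V(2)
      by (intro order.trans[OF card_mono card_Un_le]) (auto simp: G_def H_def intro!: finite_sum_pairs)
    ultimately show ?thesis
      by (simp add: N_def)
  qed
  have eq: "(\<lambda>(xs, e). e # xs) ` (SIGMA xs:disjoint_sum_pairs p P A s. G xs)
            \<subseteq> disjoint_sum_pairs p P A (Suc s)"
  proof clarify
    fix xs a b assume xs: "xs \<in> disjoint_sum_pairs p P A s" and ab: "(a, b) \<in> G xs"
    have "(a, b) \<in> sum_pairs p P A" "a \<noteq> b"
      using ab by (auto simp: G_def sum_pairs_def)
    moreover have "a \<notin> fst ` set xs" "a \<notin> snd ` set xs" "b \<notin> fst ` set xs" "b \<notin> snd ` set xs"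
      using ab by (simp_all add: G_def V_def)
    ultimately show "(a, b) # xs \<in> disjoint_sum_pairs p P A (Suc s)"
      using xs by (simp add: disjoint_sum_pairs_def)
  qed
  have "N ^ Suc s \<le> card (disjoint_sum_pairs p P A s) * N"
    using Suc by (simp add: N_def mult.commute)
  also have "\<dots> \<le> (\<Sum>xs\<in>disjoint_sum_pairs p P A s. card (G xs))"
    using sum_mono[of "disjoint_sum_pairs p P A s" "\<lambda>_. N"] G by simp
  also have "\<dots> = card (SIGMA xs:disjoint_sum_pairs p P A s. G xs)"
    using assms(1) by (subst card_SigmaI) (auto simp: G_def finite_sum_pairs)
  also have "\<dots> = card ((\<lambda>(xs, e). e # xs) ` (SIGMA xs:disjoint_sum_pairs p P A s. G xs))"
    by (subst card_image) (auto simp: inj_on_def)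
  also have "\<dots> \<le> card (disjoint_sum_pairs p P A (Suc s))"
    using eq assms(1) by (intro card_mono) auto
  finally show ?case
    by (simp add: N_def)
qed

text \<open>Markov's inequality: there are at most \<open>(p * card P) ^ s\<close> candidate
  sequences, each present with probability \<open>q ^ (2 * s)\<close>.\<close>

lemma prob_card_disjoint_sum_pairs_ge_le:
  fixes t :: real
  assumes "finite P" "0 \<le> q" "q \<le> 1" "t > 0"
  shows "measure_pmf.prob (random_subset_pmf p q) {A. t ^ s \<le> real (card (disjoint_sum_pairs p P A s))}
         \<le> (real p * real (card P) * q\<^sup>2 / t) ^ s"
proof -
  define V where "V = (\<lambda>xs :: (nat \<times> nat) list. set (map fst xs @ map snd xs))"
  define L where "L = disjoint_sum_pairs p P {..<p} s"
  \<comment> \<open>On the support, the random family is a selection from the fixed list set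
    \<open>L\<close>, so its size is a sum of indicators.\<close>
  have restrict: "disjoint_sum_pairs p P A s = {xs\<in>L. A \<in> {A. V xs \<subseteq> A}}" if "A \<subseteq> {..<p}" for A
    using that by (auto simp: L_def disjoint_sum_pairs_def V_def sum_pairs_def)
  have finL: "finite L"
    by (auto simp: L_def)
  have "measure_pmf.prob (random_subset_pmf p q) {A. t ^ s \<le> real (card (disjoint_sum_pairs p P A s))}
        = measure_pmf.prob (random_subset_pmf p q) {A. t ^ s \<le> real (card {xs\<in>L. A \<in> {A. V xs \<subseteq> A}})}"
    by (rule measure_prob_cong_0)
       (use restrict random_subset_pmf_subset[of _ p q] in \<open>force simp: pmf_eq_0_set_pmf\<close>)+
  also have "\<dots> \<le> (\<Sum>xs\<in>L. measure_pmf.prob (random_subset_pmf p q) {A. V xs \<subseteq> A}) / t ^ s"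
    using finL assms(4) by (intro prob_card_ge_le) auto
  also have "(\<Sum>xs\<in>L. measure_pmf.prob (random_subset_pmf p q) {A. V xs \<subseteq> A}) = (\<Sum>xs\<in>L. q ^ (2 * s))"
  proof (rule sum.cong)
    fix xs assume xs: "xs \<in> L"
    then have "card (V xs) = 2 * s"
      unfolding V_def by (subst distinct_card) (auto simp: L_def disjoint_sum_pairs_def)
    moreover have "V xs \<subseteq> {..<p}"
      using xs by (auto simp: V_def L_def disjoint_sum_pairs_def sum_pairs_def)
    ultimately show "measure_pmf.prob (random_subset_pmf p q) {A. V xs \<subseteq> A} = q ^ (2 * s)"
      using prob_random_subset_superset[OF _ assms(2,3)] by simp
  qed simp
  also have "\<dots> = real (card L) * q ^ (2 * s)"
    by simp
  also have "\<dots> \<le> real ((p * card P) ^ s) * q ^ (2 * s)"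
  proof -
    have "card L \<le> card {xs. set xs \<subseteq> sum_pairs p P {..<p} \<and> length xs = s}"
      unfolding L_def by (intro card_mono disjoint_sum_pairs_subset_lists finite_lists_length_eq) auto
    also have "\<dots> = card (sum_pairs p P {..<p}) ^ s"
      by (rule card_lists_length_eq) auto
    also have "\<dots> \<le> (p * card P) ^ s"
      using card_sum_pairs_le[OF assms(1)] by (intro power_mono) auto
    finally show ?thesis
      using assms(2) by (intro mult_right_mono) (auto simp del: of_nat_mult of_nat_power)
  qed
  finally show ?thesis
    using assms(4) by (simp add: divide_right_mono power_mult_distrib power_divide power_mult)
qed

section \<open>Degree bounds from sparsity\<close>

text \<open>The elements counted lie on the translate of the progression by \<open>- v\<close>,
  which has the same difference; \<open>p - v\<close> represents \<open>- v\<close>.\<close>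

lemma card_sum_in_ap_le:
  assumes "sparse_on_aps p k A" "A \<subseteq> {..<p}" "b < p" "d \<in> {1..<p}" "v < p"
  shows "card {w\<in>A. (v + w) mod p \<in> (\<lambda>i. (b + i * d) mod p) ` {..<k}} \<le> 4"
proof -
  define c where "c = (b + (p - v)) mod p"
  have "{w\<in>A. (v + w) mod p \<in> (\<lambda>i. (b + i * d) mod p) ` {..<k}}
        \<subseteq> (\<lambda>i. (c + i * d) mod p) ` {i\<in>{..<k}. (c + i * d) mod p \<in> A}"
  proof
    fix w assume "w \<in> {w\<in>A. (v + w) mod p \<in> (\<lambda>i. (b + i * d) mod p) ` {..<k}}"
    then obtain i where w: "w \<in> A" "i < k" "(v + w) mod p = (b + i * d) mod p"
      by auto
    have "(c + i * d) mod p = ((b + i * d) + (p - v)) mod p"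
      unfolding c_def by (simp add: mod_simps ac_simps)
    also have "\<dots> = ((v + w) + (p - v)) mod p"
      using w(3) by (metis mod_add_left_eq)
    also have "\<dots> = w"
      using assms(2,5) w(1) by auto
    finally show "w \<in> (\<lambda>i. (c + i * d) mod p) ` {i\<in>{..<k}. (c + i * d) mod p \<in> A}"
      using w by (intro image_eqI[of _ _ i]) auto
  qed
  then have "card {w\<in>A. (v + w) mod p \<in> (\<lambda>i. (b + i * d) mod p) ` {..<k}}
             \<le> card {i\<in>{..<k}. (c + i * d) mod p \<in> A}"
    by (rule surj_card_le[rotated]) auto
  also have "\<dots> \<le> 4"
    using assms by (auto simp: sparse_on_aps_def c_def)
  finally show ?thesis .
qed

text \<open>For odd \<open>p\<close>, \<open>h\<close> is the inverse of 2. Halving maps the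
  progression to one with difference \<open>e\<close>, nonzero because \<open>p\<close> divides
  neither \<open>h\<close> nor \<open>d\<close>.\<close>

lemma card_double_in_ap_le:
  assumes "sparse_on_aps p k A" "A \<subseteq> {..<p}" "b < p" "d \<in> {1..<p}" "prime p" "odd p"
  shows "card {a\<in>A. (a + a) mod p \<in> (\<lambda>i. (b + i * d) mod p) ` {..<k}} \<le> 4"
proof -
  define h where "h = (p + 1) div 2"
  have h2: "2 * h = p + 1"
    using assms(6) by (simp add: h_def)
  define c e where "c = (h * b) mod p" and "e = (h * d) mod p"
  have "p > 1"
    using assms(5) prime_gt_1_nat by blast
  have "\<not> p dvd h" "\<not> p dvd d"
    using assms(4) h2 \<open>p > 1\<close> by (auto dest!: dvd_imp_le)
  then have "e \<noteq> 0"
    using assms(5) by (auto simp: e_def prime_dvd_mult_iff mod_eq_0_iff_dvd)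
  then have e: "e \<in> {1..<p}" "c < p"
    using \<open>p > 1\<close> by (auto simp: e_def c_def)
  have "{a\<in>A. (a + a) mod p \<in> (\<lambda>i. (b + i * d) mod p) ` {..<k}}
        \<subseteq> (\<lambda>i. (c + i * e) mod p) ` {i\<in>{..<k}. (c + i * e) mod p \<in> A}"
  proof
    fix a assume "a \<in> {a\<in>A. (a + a) mod p \<in> (\<lambda>i. (b + i * d) mod p) ` {..<k}}"
    then obtain i where a: "a \<in> A" "i < k" "(a + a) mod p = (b + i * d) mod p"
      by auto
    have "(c + i * e) mod p = (h * b + i * (h * d)) mod p"
      unfolding c_def e_def by (intro mod_add_cong mod_mult_cong) auto
    also have "h * b + i * (h * d) = h * (b + i * d)"
      by (simp add: algebra_simps)
    also have "(h * (b + i * d)) mod p = (h * (a + a)) mod p"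
      using a(3) by (metis mod_mult_right_eq)
    also have "h * (a + a) = (2 * h) * a"
      by simp
    also have "(2 * h * a) mod p = a"
      using assms(2) a(1) by (auto simp: h2)
    finally show "a \<in> (\<lambda>i. (c + i * e) mod p) ` {i\<in>{..<k}. (c + i * e) mod p \<in> A}"
      using a by (intro image_eqI[of _ _ i]) auto
  qed
  then have "card {a\<in>A. (a + a) mod p \<in> (\<lambda>i. (b + i * d) mod p) ` {..<k}}
             \<le> card {i\<in>{..<k}. (c + i * e) mod p \<in> A}"
    by (rule surj_card_le[rotated]) auto
  also have "\<dots> \<le> 4"
    using assms(1) e by (auto simp: sparse_on_aps_def)
  finally show ?thesis .
qed

lemma prob_has_ap_mod_sumset_le:
  assumes "prime p" "odd p" "k \<le> p" "32 \<le> k"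
  defines "M \<equiv> random_subset_pmf p (1 / sqrt (real p))"
  shows "measure_pmf.prob M {A. has_ap_mod p (sumset_mod p A) k}
         \<le> real k ^ 5 / sqrt (real p) + (real p)\<^sup>2 * (2 / 3) ^ (k div 64)"
proof -
  define q where "q = 1 / sqrt (real p)"
  define s where "s = k div 64"
  define P where "P = (\<lambda>z. (\<lambda>i. (fst z + i * snd z) mod p) ` {..<k})"
  define F where "F = (\<lambda>z. {A. (3 / 2 * real k) ^ s \<le> real (card (disjoint_sum_pairs p (P z) A s))})"
  have "p > 1"
    using assms(1) prime_gt_1_nat by blast
  then have q: "0 \<le> q" "q \<le> 1" "real p * q\<^sup>2 = 1"
    by (auto simp: q_def power_divide)
  have PF: "measure_pmf.prob M (F z) \<le> (2 / 3) ^ s" if "z \<in> {..<p} \<times> {1..<p}" for z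
  proof -
    have "card (P z) = k"
      unfolding P_def using that assms by (subst card_image) (auto intro!: inj_on_ap_mod)
    then have "measure_pmf.prob M (F z) \<le> (real p * real k * q\<^sup>2 / (3 / 2 * real k)) ^ s"
      using prob_card_disjoint_sum_pairs_ge_le[of "P z" q "3 / 2 * real k" p s] q assms(4)
      by (simp add: M_def F_def q_def P_def)
    also have "real p * real k * q\<^sup>2 / (3 / 2 * real k) = 2 / 3"
      using q(3) assms(4) by (simp add: field_simps)
    finally show ?thesis .
  qed
  have "measure_pmf.prob M {A. has_ap_mod p (sumset_mod p A) k}
        \<le> measure_pmf.prob M ({A. \<not> sparse_on_aps p k A}
             \<union> {A. has_ap_mod p (sumset_mod p A) k \<and> sparse_on_aps p k A})"
    by (intro measure_pmf.finite_measure_mono) auto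
  also have "\<dots> \<le> measure_pmf.prob M {A. \<not> sparse_on_aps p k A}
             + measure_pmf.prob M {A. has_ap_mod p (sumset_mod p A) k \<and> sparse_on_aps p k A}"
    by (rule measure_subadditive) auto
  also have "measure_pmf.prob M {A. \<not> sparse_on_aps p k A} \<le> real p ^ 2 * real k ^ 5 * q ^ 5"
    unfolding M_def q_def[symmetric] using assms(1,3) q by (intro prob_not_sparse_on_aps_le)
  also have "real p ^ 2 * real k ^ 5 * q ^ 5 = (real p * q\<^sup>2)\<^sup>2 * (real k ^ 5 * q)"
    by (simp add: power_mult_distrib eval_nat_numeral)
  also have "\<dots> = real k ^ 5 / sqrt (real p)"
    using q(3) by (simp add: q_def)
  also have "measure_pmf.prob M {A. has_ap_mod p (sumset_mod p A) k \<and> sparse_on_aps p k A}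
             \<le> (\<Sum>z\<in>{..<p} \<times> {1..<p}. measure_pmf.prob M (F z))"
  proof (rule prob_le_sum_prob)
    fix A assume "A \<in> set_pmf M" "A \<in> {A. has_ap_mod p (sumset_mod p A) k \<and> sparse_on_aps p k A}"
    then have A: "A \<subseteq> {..<p}" "has_ap_mod p (sumset_mod p A) k" "sparse_on_aps p k A"
      using random_subset_pmf_subset by (auto simp: M_def)
    from A(2) obtain b d where bd: "b < p" "d \<in> {1..<p}" and
      inj: "inj_on (\<lambda>i. (b + i * d) mod p) {..<k}" and
      sub: "\<forall>i<k. (b + i * d) mod p \<in> sumset_mod p A"
      by (auto simp: has_ap_mod_def Suc_le_eq)
    have card: "card (P (b, d)) = k"
      using inj by (simp add: P_def card_image)
    have fin: "finite A"
      using A(1) finite_subset by blast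
    have "2 * (k - 4) \<le> card (sum_pairs p (P (b, d)) A)"
      using card_sum_pairs_ge[of "P (b, d)" p A 4] card_double_in_ap_le[OF A(3,1) bd assms(1,2)] sub fin card
      by (auto simp: P_def)
    \<comment> \<open>Both \<open>32 * s\<close> and 16 are at most half of \<open>k\<close>. This
      is what is needed for twice \<open>2 * (k - 4) - 16 * s\<close> to be at least
      \<open>3 * k\<close>; here \<open>16 * s\<close> is the greedy loss \<open>4 * D * t\<close>
      with \<open>D = 4\<close> and \<open>t = s\<close>.\<close>
    moreover have "32 * s + 16 \<le> k"
      using assms(4) times_div_less_eq_dividend[of 64 k] unfolding s_def[symmetric] by linarith
    ultimately have "2 * (card (sum_pairs p (P (b, d)) A) - 16 * s) \<ge> 3 * k"
      using assms(4) by linarith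
    then have "3 / 2 * real k \<le> real (card (sum_pairs p (P (b, d)) A) - 16 * s)"
      by linarith
    then have "(3 / 2 * real k) ^ s \<le> real (card (sum_pairs p (P (b, d)) A) - 16 * s) ^ s"
      by (rule power_mono) simp
    also have "\<dots> \<le> real (card (disjoint_sum_pairs p (P (b, d)) A s))"
    proof -
      have "(card (sum_pairs p (P (b, d)) A) - 4 * 4 * s) ^ s \<le> card (disjoint_sum_pairs p (P (b, d)) A s)"
        using A(1) bd card_sum_in_ap_le[OF A(3,1) bd]
        by (intro card_disjoint_sum_pairs_ge[OF fin]) (auto simp: P_def)
      then show ?thesis
        by (simp flip: of_nat_power)
    qed
    finally show "\<exists>z\<in>{..<p} \<times> {1..<p}. A \<in> F z"
      using bd by (intro bexI[of _ "(b, d)"]) (auto simp: F_def)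
  qed auto
  also have "\<dots> \<le> (\<Sum>z\<in>{..<p} \<times> {1..<p}. (2 / 3) ^ s)"
    by (intro sum_mono PF)
  also have "\<dots> = real (p * (p - 1)) * (2 / 3) ^ s"
    by (simp add: card_cartesian_product)
  also have "\<dots> \<le> (real p)\<^sup>2 * (2 / 3) ^ s"
    by (intro mult_right_mono) (auto simp: power2_eq_square mult_left_mono)
  finally show ?thesis
    by (simp add: s_def)
qed

section \<open>The lower bound\<close>

definition isolated :: "nat \<Rightarrow> nat set \<Rightarrow> nat set" where
  "isolated m B = {b\<in>B. \<forall>c\<in>B. (c < b \<longrightarrow> c + m \<le> b) \<and> (b < c \<longrightarrow> b + m \<le> c)}"

text \<open>Every element that is not isolated belongs to a close pair, and a pair accounts for at
  most two elements.\<close>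

lemma card_le_card_isolated:
  assumes "finite B"
  shows "card B \<le> card (isolated m B) + 2 * card {(a, b). a \<in> B \<and> b \<in> B \<and> a < b \<and> b < a + m}"
proof -
  define Z where "Z = {(a, b). a \<in> B \<and> b \<in> B \<and> a < b \<and> b < a + m}"
  have fin: "finite Z"
    by (rule finite_subset[of _ "B \<times> B"]) (use assms in \<open>auto simp: Z_def\<close>)
  have "B \<subseteq> isolated m B \<union> (fst ` Z \<union> snd ` Z)"
  proof
    fix b assume b: "b \<in> B"
    show "b \<in> isolated m B \<union> (fst ` Z \<union> snd ` Z)"
    proof (cases "b \<in> isolated m B")
      case False
      then obtain c where "c \<in> B" "c < b \<and> b < c + m \<or> b < c \<and> c < b + m"
        using b by (auto simp: isolated_def not_le)
      then have "(c, b) \<in> Z \<or> (b, c) \<in> Z"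
        using b by (auto simp: Z_def)
      then show ?thesis
        by force
    qed auto
  qed
  then have "card B \<le> card (isolated m B \<union> (fst ` Z \<union> snd ` Z))"
    using assms fin by (intro card_mono) (auto simp: isolated_def)
  also have "\<dots> \<le> card (isolated m B) + (card Z + card Z)"
    using fin by (intro order.trans[OF card_Un_le] add_mono card_image_le) auto
  finally show ?thesis
    by (simp add: Z_def)
qed

text \<open>With fewer than \<open>n\<close> isolated elements, either the set has at most
  \<open>3 * n\<close> elements in the interval or there are at least \<open>n\<close> close pairs.
  The lower tail bounds the first event; Markov's inequality over at most \<open>p * m\<close> pairs
  bounds the second.\<close>

lemma prob_card_isolated_less_le:
  assumes "0 < n" "h \<le> p" "0 \<le> q" "q \<le> 1"
  shows "measure_pmf.prob (random_subset_pmf p q) {A. card (isolated m (A \<inter> {m..<h})) < n}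
         \<le> 2 powr (3 * real n) * exp (- q * real (h - m) / 2) + real p * real m * q\<^sup>2 / real n"
proof -
  define L where "L = {m..<h}"
  define M where "M = random_subset_pmf p q"
  define Z where "Z = {(a, b). a \<in> L \<and> b \<in> L \<and> a < b \<and> b < a + m}"
  define F where "F = (\<lambda>z :: nat \<times> nat. {A. {fst z, snd z} \<subseteq> A})"
  have L: "L \<subseteq> {..<p}" "finite L"
    using assms(2) by (auto simp: L_def)
  have "Z \<subseteq> (\<lambda>(a, i). (a, a + i)) ` (L \<times> {..<m})"
  proof
    fix z assume "z \<in> Z"
    then show "z \<in> (\<lambda>(a, i). (a, a + i)) ` (L \<times> {..<m})"
      by (intro image_eqI[of _ _ "(fst z, snd z - fst z)"]) (auto simp: Z_def)
  qed
  then have "finite Z" "card Z \<le> card (L \<times> {..<m})"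
    using L(2) surj_card_le[of "L \<times> {..<m}" Z] by (auto intro: finite_subset)
  moreover have "card L \<le> p"
    using card_mono[OF _ L(1)] by simp
  ultimately have Z: "finite Z" "card Z \<le> p * m"
    by (auto simp: card_cartesian_product intro: order.trans[OF _ mult_right_mono])
  have "measure_pmf.prob M {A. card (isolated m (A \<inter> L)) < n}
        \<le> measure_pmf.prob M ({A. real (card (A \<inter> L)) \<le> 3 * real n}
            \<union> {A. real n \<le> real (card {z\<in>Z. A \<in> F z})})"
  proof (rule measure_pmf.finite_measure_mono)
    show "{A. card (isolated m (A \<inter> L)) < n} \<subseteq>
          {A. real (card (A \<inter> L)) \<le> 3 * real n} \<union> {A. real n \<le> real (card {z\<in>Z. A \<in> F z})}"
    proof
      fix A assume A: "A \<in> {A. card (isolated m (A \<inter> L)) < n}"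
      have "{(a, b). a \<in> A \<inter> L \<and> b \<in> A \<inter> L \<and> a < b \<and> b < a + m} = {z\<in>Z. A \<in> F z}"
        by (auto simp: Z_def F_def)
      then have "card (A \<inter> L) \<le> card (isolated m (A \<inter> L)) + 2 * card {z\<in>Z. A \<in> F z}"
        using card_le_card_isolated[of "A \<inter> L" m] L(2) by simp
      then show "A \<in> {A. real (card (A \<inter> L)) \<le> 3 * real n} \<union> {A. real n \<le> real (card {z\<in>Z. A \<in> F z})}"
        using A by auto
    qed
  qed auto
  also have "\<dots> \<le> measure_pmf.prob M {A. real (card (A \<inter> L)) \<le> 3 * real n}
              + measure_pmf.prob M {A. real n \<le> real (card {z\<in>Z. A \<in> F z})}"
    by (rule measure_subadditive) auto
  also have "\<dots> \<le> 2 powr (3 * real n) * exp (- q * real (card L) / 2)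
                  + (\<Sum>z\<in>Z. measure_pmf.prob M (F z)) / real n"
    unfolding M_def using assms L(1) Z(1)
    by (intro add_mono prob_card_random_subset_le prob_card_ge_le) auto
  also have "(\<Sum>z\<in>Z. measure_pmf.prob M (F z)) = (\<Sum>z\<in>Z. q\<^sup>2)"
  proof (rule sum.cong)
    fix z assume "z \<in> Z"
    then have "{fst z, snd z} \<subseteq> {..<p}" "card {fst z, snd z} = 2"
      using L(1) by (auto simp: Z_def)
    then show "measure_pmf.prob M (F z) = q\<^sup>2"
      using prob_random_subset_superset[OF _ assms(3,4), of "{fst z, snd z}" p] by (simp add: M_def F_def)
  qed simp
  also have "\<dots> = real (card Z) * q\<^sup>2"
    by simp
  also have "\<dots> / real n \<le> real (p * m) * q\<^sup>2 / real n"
    using Z(2) by (intro divide_right_mono mult_right_mono) (auto simp del: of_nat_mult)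
  finally show ?thesis
    by (simp add: M_def L_def)
qed

text \<open>
  The elements that have to be in the random set in order that \<open>x\<close> is a sum with an isolated element
  of \<open>B\<close>. Isolation makes these sets disjoint for \<open>x < m\<close>.
\<close>

definition partners :: "nat \<Rightarrow> nat \<Rightarrow> nat set \<Rightarrow> nat \<Rightarrow> nat set" where
  "partners p m B x = (\<lambda>b. x + p - b) ` isolated m B"

lemma card_partners:
  assumes "B \<subseteq> {m..<h}" "h \<le> p"
  shows "card (partners p m B x) = card (isolated m B)"
  unfolding partners_def
proof (rule card_image, rule inj_onI)
  fix b c assume "b \<in> isolated m B" "c \<in> isolated m B" and eq: "x + p - b = x + p - c"
  then have "b \<le> x + p" "c \<le> x + p"
    using assms by (force simp: isolated_def)+
  with eq show "b = c"
    by linarith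
qed

text \<open>This separates the partners from the revealed part below \<open>h\<close>:
  \<open>x < m \<le> b\<close> keeps \<open>x + p - b\<close> below \<open>p\<close>, and
  \<open>b < h\<close> keeps it above \<open>p - h \<ge> h\<close>.\<close>

lemma partners_subset:
  assumes "B \<subseteq> {m..<h}" "2 * h \<le> p" "x < m"
  shows "partners p m B x \<subseteq> {h..<p}"
proof
  fix y assume "y \<in> partners p m B x"
  then obtain b where "y = x + p - b" "m \<le> b" "b < h"
    using assms(1) by (auto simp: partners_def isolated_def)
  then show "y \<in> {h..<p}"
    using assms(2,3) by auto
qed

text \<open>A common partner of \<open>x < y\<close> would give two isolated elements at distance
  \<open>y - x\<close>, which is positive and less than \<open>m\<close>.\<close>

lemma disjoint_family_partners:
  assumes "B \<subseteq> {m..<h}" "h \<le> p"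
  shows "disjoint_family_on (partners p m B) {..<m}"
proof -
  have False
    if bc: "b \<in> isolated m B" "c \<in> isolated m B" and "x < y" "y < m" "x + p - b = y + p - c" for x y b c
  proof -
    have "b \<in> B" "c \<in> B" "b < p" "c < p"
      using bc assms by (force simp: isolated_def)+
    then have "c = b + (y - x)"
      using that(3,5) by linarith
    then have "b < c" "c < b + m"
      using that(3,4) by auto
    then show False
      using bc \<open>c \<in> B\<close> by (force simp: isolated_def)
  qed
  then have "partners p m B x \<inter> partners p m B y = {}" if "x < y" "y < m" for x y
    using that unfolding partners_def by blast
  then show ?thesis
    unfolding disjoint_family_on_def by (metis Int_commute lessThan_iff linorder_neqE_nat)
qed

lemma mem_sumset_mod_if_partner:
  assumes "A \<inter> {m..<h} = B" "h \<le> p" "x < m" "m \<le> h" "A \<inter> partners p m B x \<noteq> {}"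
  shows "x \<in> sumset_mod p A"
proof -
  obtain b where b: "b \<in> isolated m B" "x + p - b \<in> A"
    using assms(5) by (auto simp: partners_def)
  then have "b \<in> A" "b < h"
    using assms(1) by (auto simp: isolated_def)
  moreover have "(b + (x + p - b)) mod p = x"
    using \<open>b < h\<close> assms(2-4) by simp
  ultimately show ?thesis
    using b(2) by (force simp: sumset_mod_def)
qed

lemma has_ap_mod_interval:
  assumes "{a..<a + k} \<subseteq> X" "a + k \<le> p" "p \<ge> 2" "k > 0"
  shows "has_ap_mod p X k"
  unfolding has_ap_mod_def
proof (rule bexI[of _ a], rule bexI[of _ 1], intro conjI)
  have "(a + i * 1) mod p = a + i" if "i < k" for i
    using that assms by simp
  then show "inj_on (\<lambda>i. (a + i * 1) mod p) {..<k}" "\<forall>i<k. (a + i * 1) mod p \<in> X"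
    using assms(1) by (auto simp: inj_on_def)
qed (use assms in auto)

section \<open>Covering a block of consecutive residues\<close>

text \<open>For fixed \<open>B\<close>, different blocks depend on disjoint sets of partners and are
  therefore independent. All \<open>k\<close> elements of a block are hit with probability at least
  \<open>(1 - (1 - q) ^ n) ^ k\<close>.\<close>

lemma prob_no_block_hit_le:
  assumes "B \<subseteq> {m * k..<h}" "2 * h \<le> p" "n \<le> card (isolated (m * k) B)" "0 \<le> q" "q \<le> 1"
  shows "measure_pmf.prob (random_subset_pmf p q)
           {A. \<forall>j\<in>{..<m}. \<exists>x\<in>{j * k..<j * k + k}. A \<inter> partners p (m * k) B x = {}}
         \<le> (1 - (1 - (1 - q) ^ n) ^ k) ^ m"
proof -
  define M where "M = random_subset_pmf p q"
  define W where "W = partners p (m * k) B"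
  define I where "I = (\<lambda>j. {j * k..<j * k + k})"
  define S where "S = (\<lambda>j. \<Union>x\<in>I j. W x)"
  have block: "I j \<subseteq> {..<m * k}" if "j < m" for j
  proof -
    have "Suc j * k \<le> m * k"
      using that by (intro mult_right_mono) auto
    then show ?thesis
      by (auto simp: I_def)
  qed
  have disj: "disjoint_family_on W {..<m * k}"
    unfolding W_def using assms(1,2) by (intro disjoint_family_partners[of B _ h]) auto
  have W: "W x \<subseteq> {..<p}" "card (W x) \<ge> n" if "x < m * k" for x
    using partners_subset[OF assms(1,2) that] card_partners[OF assms(1), of p x] assms(2,3)
    by (auto simp: W_def)
  have I_eq: "x div k = j" if "x \<in> I j" for x j
    using that by (intro div_nat_eqI) (auto simp: I_def algebra_simps)
  have "disjoint_family_on S {..<m}"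
    unfolding disjoint_family_on_def
  proof (intro ballI impI)
    fix i j assume ij: "i \<in> {..<m}" "j \<in> {..<m}" "i \<noteq> j"
    have "W x \<inter> W y = {}" if "x \<in> I i" "y \<in> I j" for x y
      using disj that ij block[of i] block[of j] I_eq unfolding disjoint_family_on_def
      by (metis lessThan_iff subsetD)
    then show "S i \<inter> S j = {}"
      unfolding S_def by blast
  qed
  moreover have "S j \<subseteq> {..<p}" if "j \<in> {..<m}" for j
    using W(1) block[of j] that by (auto simp: S_def)
  ultimately have "measure_pmf.prob M {A. \<forall>j\<in>{..<m}. \<exists>x\<in>I j. (A \<inter> S j) \<inter> W x = {}}
        = (\<Prod>j<m. measure_pmf.prob M {A. \<exists>x\<in>I j. (A \<inter> S j) \<inter> W x = {}})"
    unfolding M_def by (intro prob_random_subset_indep) auto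
  also have "\<dots> \<le> (\<Prod>j<m. 1 - (1 - (1 - q) ^ n) ^ k)"
  proof (intro prod_mono conjI)
    fix j assume j: "j \<in> {..<m}"
    have SW: "(A \<inter> S j) \<inter> W x = A \<inter> W x" if "x \<in> I j" for A x
      using that by (auto simp: S_def)
    have "{A. \<exists>x\<in>I j. (A \<inter> S j) \<inter> W x = {}} = UNIV - {A. \<forall>x\<in>I j. A \<inter> W x \<noteq> {}}"
      using SW by auto
    then have "measure_pmf.prob M {A. \<exists>x\<in>I j. (A \<inter> S j) \<inter> W x = {}}
               = 1 - measure_pmf.prob M {A. \<forall>x\<in>I j. A \<inter> W x \<noteq> {}}"
      using measure_pmf.prob_compl[of "{A. \<forall>x\<in>I j. A \<inter> W x \<noteq> {}}" M] by simp
    moreover have "(1 - (1 - q) ^ n) ^ card (I j) \<le> measure_pmf.prob M {A. \<forall>x\<in>I j. A \<inter> W x \<noteq> {}}"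
      unfolding M_def
    proof (rule prob_random_subset_hits_all_ge)
      show "disjoint_family_on W (I j)"
        using disj block j by (auto intro: disjoint_family_on_mono)
      fix x assume "x \<in> I j"
      then have "x < m * k"
        using block[of j] j by auto
      then show "W x \<subseteq> {..<p}" "n \<le> card (W x)"
        by (rule W)+
    qed (use assms(4,5) in \<open>auto simp: I_def\<close>)
    ultimately show "measure_pmf.prob M {A. \<exists>x\<in>I j. (A \<inter> S j) \<inter> W x = {}} \<le> 1 - (1 - (1 - q) ^ n) ^ k"
      by (simp add: I_def)
  qed auto
  \<comment> \<open>The intersection with \<open>S j\<close> only put the events into the form
    required for independence.\<close>
  also have "{A. \<forall>j\<in>{..<m}. \<exists>x\<in>I j. (A \<inter> S j) \<inter> W x = {}}
             = {A. \<forall>j\<in>{..<m}. \<exists>x\<in>I j. A \<inter> W x = {}}"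
  proof -
    have "(A \<inter> S j) \<inter> W x = A \<inter> W x" if "x \<in> I j" for A x j
      using that by (auto simp: S_def)
    then show ?thesis
      by auto
  qed
  finally show ?thesis
    by (simp add: M_def W_def I_def)
qed

text \<open>Condition on \<open>B = A \<inter> L\<close>. For a good \<open>B\<close> the failure of
  all blocks depends on \<open>A \<inter> H\<close> only, with \<open>H\<close> disjoint from
  \<open>L\<close>, so the bound for fixed \<open>B\<close> survives averaging.\<close>

lemma prob_not_has_ap_mod_sumset_le:
  assumes "0 < k" "m * k \<le> h" "2 * h \<le> p" "p \<ge> 2" "0 \<le> q" "q \<le> 1"
  shows "measure_pmf.prob (random_subset_pmf p q) {A. \<not> has_ap_mod p (sumset_mod p A) k}
         \<le> measure_pmf.prob (random_subset_pmf p q) {A. card (isolated (m * k) (A \<inter> {m * k..<h})) < n}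
           + (1 - (1 - (1 - q) ^ n) ^ k) ^ m"
proof -
  define M where "M = random_subset_pmf p q"
  define L where "L = {m * k..<h}"
  define H where "H = {h..<p}"
  define G where "G = {B. B \<subseteq> L \<and> n \<le> card (isolated (m * k) B)}"
  define bad where "bad = (\<lambda>B A. \<forall>j\<in>{..<m}. \<exists>x\<in>{j * k..<j * k + k}. A \<inter> partners p (m * k) B x = {})"
  define \<epsilon> where "\<epsilon> = (1 - (1 - (1 - q) ^ n) ^ k) ^ m"
  have block: "j * k + k \<le> m * k" if "j < m" for j
  proof -
    have "Suc j * k \<le> m * k"
      using that by (intro mult_right_mono) auto
    then show ?thesis
      by simp
  qed
  have badH: "bad B (A \<inter> H) \<longleftrightarrow> bad B A" if "B \<in> G" for A B
  proof -
    have "(A \<inter> H) \<inter> partners p (m * k) B x = A \<inter> partners p (m * k) B x"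
      if "j < m" "x \<in> {j * k..<j * k + k}" for j x
      using partners_subset[of B "m * k" h p x] that block[of j] \<open>B \<in> G\<close> assms(3)
      by (auto simp: G_def L_def H_def)
    then show ?thesis
      unfolding bad_def by (metis lessThan_iff)
  qed
  have finG: "finite G"
    by (rule finite_subset[of _ "Pow L"]) (auto simp: G_def L_def)
  have "measure_pmf.prob M {A. \<not> has_ap_mod p (sumset_mod p A) k}
        \<le> measure_pmf.prob M ({A. card (isolated (m * k) (A \<inter> L)) < n}
            \<union> (\<Union>B\<in>G. {A. A \<inter> L = B \<and> bad B (A \<inter> H)}))"
  proof (rule measure_pmf.finite_measure_mono)
    show "{A. \<not> has_ap_mod p (sumset_mod p A) k}
          \<subseteq> {A. card (isolated (m * k) (A \<inter> L)) < n} \<union> (\<Union>B\<in>G. {A. A \<inter> L = B \<and> bad B (A \<inter> H)})"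
    proof
      fix A assume A: "A \<in> {A. \<not> has_ap_mod p (sumset_mod p A) k}"
      have "bad (A \<inter> L) A"
      proof (rule ccontr)
        assume "\<not> bad (A \<inter> L) A"
        then obtain j where j: "j < m"
          "\<And>x. x \<in> {j * k..<j * k + k} \<Longrightarrow> A \<inter> partners p (m * k) (A \<inter> L) x \<noteq> {}"
          by (auto simp: bad_def)
        have "{j * k..<j * k + k} \<subseteq> sumset_mod p A"
        proof
          fix x assume x: "x \<in> {j * k..<j * k + k}"
          show "x \<in> sumset_mod p A"
            by (rule mem_sumset_mod_if_partner[of A "m * k" h "A \<inter> L"])
               (use j(2)[OF x] block[OF j(1)] x assms in \<open>auto simp: L_def\<close>)
        qed
        then have "has_ap_mod p (sumset_mod p A) k"
          using block[OF j(1)] assms by (intro has_ap_mod_interval[of "j * k"]) auto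
        then show False
          using A by simp
      qed
      then show "A \<in> {A. card (isolated (m * k) (A \<inter> L)) < n} \<union> (\<Union>B\<in>G. {A. A \<inter> L = B \<and> bad B (A \<inter> H)})"
        using badH[of "A \<inter> L" A] by (cases "A \<inter> L \<in> G") (auto simp: G_def)
    qed
  qed auto
  also have "\<dots> \<le> measure_pmf.prob M {A. card (isolated (m * k) (A \<inter> L)) < n}
                   + measure_pmf.prob M (\<Union>B\<in>G. {A. A \<inter> L = B \<and> bad B (A \<inter> H)})"
    by (rule measure_subadditive) auto
  also have "measure_pmf.prob M (\<Union>B\<in>G. {A. A \<inter> L = B \<and> bad B (A \<inter> H)}) \<le> \<epsilon>"
  proof -
    have "measure_pmf.prob M (\<Union>B\<in>G. {A. A \<inter> L = B \<and> bad B (A \<inter> H)})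
          \<le> (\<Sum>B\<in>G. measure_pmf.prob M {A. A \<inter> L = B \<and> bad B (A \<inter> H)})"
      using finG by (intro measure_pmf.finite_measure_subadditive_finite) auto
    also have "\<dots> = (\<Sum>B\<in>G. measure_pmf.prob M {A. A \<inter> L = B} * measure_pmf.prob M {A. bad B (A \<inter> H)})"
      unfolding M_def using assms(3)
      by (intro sum.cong prob_random_subset_indep2) (auto simp: L_def H_def)
    also have "\<dots> \<le> (\<Sum>B\<in>G. measure_pmf.prob M {A. A \<inter> L = B} * \<epsilon>)"
    proof (intro sum_mono mult_left_mono)
      fix B assume "B \<in> G"
      then show "measure_pmf.prob M {A. bad B (A \<inter> H)} \<le> \<epsilon>"
        unfolding badH[OF \<open>B \<in> G\<close>] unfolding M_def bad_def \<epsilon>_def using assms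
        by (intro prob_no_block_hit_le) (auto simp: G_def L_def)
    qed auto
    \<comment> \<open>The events \<open>A \<inter> L = B\<close> are disjoint, so their
      probabilities sum to at most 1.\<close>
    also have "\<dots> = measure_pmf.prob M (\<Union>B\<in>G. {A. A \<inter> L = B}) * \<epsilon>"
      using finG
      by (subst measure_pmf.finite_measure_finite_Union) (auto simp: disjoint_family_on_def sum_distrib_right)
    also have "\<dots> \<le> 1 * \<epsilon>"
      using assms(5,6) unfolding \<epsilon>_def
      by (intro mult_right_mono measure_pmf.prob_le_1 zero_le_power) (simp add: power_le_one)
    finally show ?thesis
      by simp
  qed
  finally show ?thesis
    by (simp add: M_def L_def \<epsilon>_def)
qed

section \<open>Asymptotics\<close>

lemma eventually_at_top_primeI:
  assumes "eventually P at_top" "eventually Q at_top"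
    and "\<And>p. prime p \<Longrightarrow> P p \<Longrightarrow> Q p \<Longrightarrow> R p"
  shows "eventually R (inf at_top (principal {p :: nat. prime p}))"
  unfolding eventually_inf_principal using assms(1,2) by eventually_elim (use assms(3) in auto)

text \<open>The constant is 64 times 3 over \<open>ln (3 / 2)\<close>: with it
  \<open>(2 / 3) ^ (k div 64)\<close> is of order \<open>p\<close> to the power -3, which beats the
  factor \<open>p ^ 2\<close>.\<close>

lemma prob_long_ap_tendsto_0:
  defines "c \<equiv> 192 / ln (3 / 2 :: real)"
  shows "((\<lambda>p. measure_pmf.prob (random_subset_pmf p (1 / sqrt (real p)))
            {A. has_ap_mod p (sumset_mod p A) (nat \<lfloor>c * ln (real p)\<rfloor> + 1)}) \<longlongrightarrow> 0)
         (inf at_top (principal {p :: nat. prime p}))"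
proof -
  define k where "k = (\<lambda>p :: nat. nat \<lfloor>c * ln (real p)\<rfloor> + 1)"
  define g where "g = (\<lambda>p :: nat. (c * ln (real p) + 1) ^ 5 / sqrt (real p) + 3 / 2 / real p)"
  have c: "c > 0"
    by (simp add: c_def)
  have g: "(g \<longlongrightarrow> 0) (inf at_top (principal {p :: nat. prime p}))"
  proof (rule tendsto_mono[OF inf_le1])
    show "g \<longlonglongrightarrow> 0"
      unfolding g_def using c by real_asymp
  qed
  have "eventually (\<lambda>p :: nat. c * ln (real p) + 1 \<le> real p) at_top"
    using c by real_asymp
  moreover have "eventually (\<lambda>p :: nat. 32 \<le> c * ln (real p) \<and> p > 2) at_top"
    using c by (intro eventually_conj eventually_gt_at_top) real_asymp
  ultimately have "eventually (\<lambda>p. measure_pmf.prob (random_subset_pmf p (1 / sqrt (real p)))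
          {A. has_ap_mod p (sumset_mod p A) (k p)} \<le> g p) (inf at_top (principal {p :: nat. prime p}))"
  proof (rule eventually_at_top_primeI)
    fix p :: nat assume p: "prime p" "c * ln (real p) + 1 \<le> real p" "32 \<le> c * ln (real p) \<and> p > 2"
    have k: "c * ln (real p) \<le> real (k p)" "real (k p) \<le> c * ln (real p) + 1"
      unfolding k_def using p(3) by linarith+
    then have "real (k p) \<le> real p" "real 32 \<le> real (k p)"
      using p(2,3) by auto
    then have k': "k p \<le> p" "32 \<le> k p"
      by (simp_all only: of_nat_le_iff)
    have "odd p"
      using p(1,3) prime_odd_nat by blast
    have "measure_pmf.prob (random_subset_pmf p (1 / sqrt (real p))) {A. has_ap_mod p (sumset_mod p A) (k p)}
          \<le> real (k p) ^ 5 / sqrt (real p) + (real p)\<^sup>2 * (2 / 3) ^ (k p div 64)"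
      using p(1) \<open>odd p\<close> k' by (rule prob_has_ap_mod_sumset_le)
    also have "(2 / 3 :: real) ^ (k p div 64) \<le> 3 / 2 * real p powr -3"
    proof -
      have "real (k p) \<le> real (64 * (k p div 64) + 64)"
        by (rule of_nat_mono) linarith
      then have "real (k p) \<le> 64 * real (k p div 64) + 64"
        by simp
      \<comment> \<open>Rounding down in \<open>div\<close> costs at most one, whence the factor
        \<open>3 / 2\<close> below.\<close>
      then have div: "c * ln (real p) / 64 - 1 \<le> real (k p div 64)"
        using k(1) by linarith
      have "(2 / 3 :: real) ^ (k p div 64) = (2 / 3) powr real (k p div 64)"
        by (simp add: powr_realpow)
      also have "\<dots> \<le> (2 / 3) powr (c * ln (real p) / 64 - 1)"
        using div by (intro powr_mono') auto
      also have "\<dots> = exp ((c * ln (real p) / 64 - 1) * - ln (3 / 2))"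
        by (simp add: powr_def ln_div)
      also have "(c * ln (real p) / 64 - 1) * - ln (3 / 2) = ln (3 / 2) + -3 * ln (real p)"
        by (simp add: c_def field_simps)
      also have "exp \<dots> = 3 / 2 * real p powr -3"
        using p(3) by (simp only: exp_add) (simp add: powr_def)
      finally show ?thesis .
    qed
    also have "(real p)\<^sup>2 * (3 / 2 * real p powr -3) = 3 / 2 / real p"
      using p(3) by (simp add: powr_minus field_simps eval_nat_numeral powr_numeral)
    also have "real (k p) ^ 5 / sqrt (real p) \<le> (c * ln (real p) + 1) ^ 5 / sqrt (real p)"
      using k(2) by (intro divide_right_mono power_mono) auto
    finally show "measure_pmf.prob (random_subset_pmf p (1 / sqrt (real p)))
          {A. has_ap_mod p (sumset_mod p A) (k p)} \<le> g p"
      by (simp add: g_def mult_left_mono)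
  qed
  then have "((\<lambda>p. measure_pmf.prob (random_subset_pmf p (1 / sqrt (real p)))
        {A. has_ap_mod p (sumset_mod p A) (k p)}) \<longlongrightarrow> 0) (inf at_top (principal {p :: nat. prime p}))"
    by (rule tendsto_sandwich[OF always_eventually _ tendsto_const g, rotated]) simp
  then show ?thesis
    by (simp only: k_def)
qed

text \<open>With at least \<open>sqrt p / 100\<close> partners a residue is hit with probability at
  least \<gamma>. The choice of \<open>c\<close> makes \<gamma> to the power \<open>c * ln p\<close>
  equal to \<open>p powr (- 1 / 16)\<close>, while there are about \<open>p powr (1 / 8)\<close>
  blocks.\<close>

lemma prob_no_ap_tendsto_0:
  defines "\<gamma> \<equiv> 1 - exp (- 1 / 100 :: real)"
  defines "c \<equiv> 1 / (16 * - ln \<gamma>)"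
  shows "c > 0"
    and "((\<lambda>p. measure_pmf.prob (random_subset_pmf p (1 / sqrt (real p)))
            {A. \<not> has_ap_mod p (sumset_mod p A) (nat \<lceil>c * ln (real p)\<rceil>)}) \<longlongrightarrow> 0)
         (inf at_top (principal {p :: nat. prime p}))"
proof -
  define k where "k = (\<lambda>p :: nat. nat \<lceil>c * ln (real p)\<rceil>)"
  define m where "m = (\<lambda>p :: nat. nat \<lceil>real p powr (1 / 8)\<rceil>)"
  \<comment> \<open>The divisor 100 is large enough for the exponent \<open>3 * sqrt p / 100\<close>
    from the lower tail to lose against \<open>sqrt p / 8\<close>.\<close>
  define n where "n = (\<lambda>p :: nat. nat \<lceil>sqrt (real p) / 100\<rceil>)"
  define mk where "mk = (\<lambda>p :: nat. (real p powr (1 / 8) + 1) * (c * ln (real p) + 1))"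
  \<comment> \<open>The summands bound the events of too few revealed elements, of too many close
    pairs, and of no covered block.\<close>
  define g where "g = (\<lambda>p :: nat. exp (3 * (sqrt (real p) / 100 + 1)) * exp (- sqrt (real p) / 8)
      + mk p / (sqrt (real p) / 100) + exp (- (real p powr (1 / 8) * (\<gamma> * real p powr (- 1 / 16)))))"
  have \<gamma>: "0 < \<gamma>" "\<gamma> < 1"
    by (simp_all add: \<gamma>_def)
  then show c: "c > 0"
    by (simp add: c_def)
  have g: "(g \<longlongrightarrow> 0) (inf at_top (principal {p :: nat. prime p}))"
  proof (rule tendsto_mono[OF inf_le1])
    show "g \<longlonglongrightarrow> 0"
      unfolding g_def mk_def using c \<gamma> by real_asymp
  qed
  \<comment> \<open>This leaves at least \<open>p / 4\<close> residues between \<open>m * k\<close>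
    and \<open>p div 2\<close>; the 1 absorbs the rounding of \<open>p div 2\<close>.\<close>
  have "eventually (\<lambda>p :: nat. mk p \<le> real p / 4 - 1) at_top"
    unfolding mk_def using c by real_asymp
  moreover have "eventually (\<lambda>p :: nat. p > 1) at_top"
    by (rule eventually_gt_at_top)
  ultimately have "eventually (\<lambda>p. measure_pmf.prob (random_subset_pmf p (1 / sqrt (real p)))
          {A. \<not> has_ap_mod p (sumset_mod p A) (k p)} \<le> g p) (inf at_top (principal {p :: nat. prime p}))"
  proof (rule eventually_at_top_primeI)
    fix p :: nat assume p: "prime p" "mk p \<le> real p / 4 - 1" "p > 1"
    define q where "q = 1 / sqrt (real p)"
    define h where "h = p div 2"
    have sq: "sqrt (real p) > 0" "ln (real p) > 0"
      using p(3) by auto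
    have q: "0 \<le> q" "q \<le> 1" "real p * q\<^sup>2 = 1"
      using p(3) by (auto simp: q_def power_divide)
    have "0 < c * ln (real p)"
      using c sq(2) by simp
    then have k: "0 < k p" "real (k p) \<le> c * ln (real p) + 1"
      unfolding k_def by linarith+
    have m: "real p powr (1 / 8) \<le> real (m p)" "real (m p) \<le> real p powr (1 / 8) + 1"
      unfolding m_def using powr_ge_zero[of "real p" "1 / 8"] by linarith+
    have n: "sqrt (real p) / 100 \<le> real (n p)" "real (n p) \<le> sqrt (real p) / 100 + 1"
      unfolding n_def using sq(1) by linarith+
    then have "0 < n p"
      using sq(1) by (cases "n p = 0") auto
    have mk: "real (m p * k p) \<le> mk p"
      unfolding mk_def of_nat_mult using m(2) k(2) by (intro mult_mono) auto
    have "real p / 2 - 1 \<le> real h"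
      unfolding h_def by linarith
    then have h: "m p * k p \<le> h" "real p / 4 \<le> real (h - m p * k p)"
      using p(2) mk by linarith+
    define M where "M = random_subset_pmf p q"
    have "measure_pmf.prob M {A. \<not> has_ap_mod p (sumset_mod p A) (k p)}
          \<le> measure_pmf.prob M {A. card (isolated (m p * k p) (A \<inter> {m p * k p..<h})) < n p}
            + (1 - (1 - (1 - q) ^ n p) ^ k p) ^ m p"
      unfolding M_def using k(1) h(1) p(3) q by (intro prob_not_has_ap_mod_sumset_le) (auto simp: h_def)
    also have "measure_pmf.prob M {A. card (isolated (m p * k p) (A \<inter> {m p * k p..<h})) < n p}
               \<le> 2 powr (3 * real (n p)) * exp (- q * real (h - m p * k p) / 2)
                 + real p * real (m p * k p) * q\<^sup>2 / real (n p)"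
      unfolding M_def using \<open>0 < n p\<close> q by (intro prob_card_isolated_less_le) (auto simp: h_def)
    also have "real p * real (m p * k p) * q\<^sup>2 = (real p * q\<^sup>2) * real (m p * k p)"
      by (simp only: ac_simps)
    also have "\<dots> = real (m p * k p)"
      by (simp only: q(3) mult_1)
    also have "real (m p * k p) / real (n p) \<le> mk p / (sqrt (real p) / 100)"
    proof (rule frac_le[OF _ mk _ n(1)])
      show "0 \<le> mk p"
        using mk by (rule order.trans[OF of_nat_0_le_iff])
    qed (use sq(1) in simp)
    also have "2 powr (3 * real (n p)) * exp (- q * real (h - m p * k p) / 2)
               \<le> exp (3 * (sqrt (real p) / 100 + 1)) * exp (- sqrt (real p) / 8)"
    proof (intro mult_mono)
      have "q * (real p / 4) \<le> q * real (h - m p * k p)"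
        using h(2) q(1) by (rule mult_left_mono)
      moreover have "q * (real p / 4) = sqrt (real p) / 4"
        unfolding q_def by (simp add: real_div_sqrt)
      ultimately show "exp (- q * real (h - m p * k p) / 2) \<le> exp (- sqrt (real p) / 8)"
        by simp
      have "3 * real (n p) * ln 2 \<le> 3 * real (n p) * 1"
        using ln_2_less_1 by (intro mult_left_mono) auto
      then show "2 powr (3 * real (n p)) \<le> exp (3 * (sqrt (real p) / 100 + 1))"
        using n(2) unfolding powr_def by simp
    qed auto
    also have "(1 - (1 - (1 - q) ^ n p) ^ k p) ^ m p
               \<le> exp (- (real p powr (1 / 8) * (\<gamma> * real p powr (- 1 / 16))))"
    proof -
      have "(1 - q) ^ n p \<le> exp (- q) ^ n p"
        using q exp_ge_add_one_self[of "- q"] by (intro power_mono) auto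
      also have "\<dots> = exp (- (q * real (n p)))"
        by (simp flip: exp_of_nat_mult add: mult.commute)
      also have "\<dots> \<le> exp (- 1 / 100)"
        using mult_left_mono[OF n(1) q(1)] sq(1) by (simp add: q_def)
      finally have \<gamma>_le: "\<gamma> \<le> 1 - (1 - q) ^ n p"
        by (simp add: \<gamma>_def)
      have "c * ln (real p) * ln \<gamma> = - 1 / 16 * ln (real p)"
        using \<gamma> by (simp add: c_def)
      then have "\<gamma> powr (c * ln (real p)) = real p powr (- 1 / 16)"
        using p(3) \<gamma> by (simp add: powr_def)
      \<comment> \<open>The extra factor \<gamma> pays for rounding \<open>k\<close> up.\<close>
      then have "\<gamma> * real p powr (- 1 / 16) = \<gamma> powr (c * ln (real p) + 1)"
        using \<gamma> by (simp add: powr_add)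
      also have "\<dots> \<le> \<gamma> powr real (k p)"
        using k(2) \<gamma> by (intro powr_mono') auto
      also have "\<dots> = \<gamma> ^ k p"
        using \<gamma> by (simp add: powr_realpow)
      also have "\<dots> \<le> (1 - (1 - q) ^ n p) ^ k p"
        using \<gamma>_le \<gamma> by (intro power_mono) auto
      finally have hit: "\<gamma> * real p powr (- 1 / 16) \<le> (1 - (1 - q) ^ n p) ^ k p" .
      define r where "r = (1 - (1 - q) ^ n p) ^ k p"
      have "r \<le> 1"
        unfolding r_def using q by (intro power_le_one) (auto intro!: power_le_one)
      then have "(1 - r) ^ m p \<le> exp (- r) ^ m p"
        using exp_ge_add_one_self[of "- r"] by (intro power_mono) auto
      also have "\<dots> = exp (- (real (m p) * r))"
        by (simp flip: exp_of_nat_mult)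
      also have "\<dots> \<le> exp (- (real p powr (1 / 8) * (\<gamma> * real p powr (- 1 / 16))))"
        using m(1) hit \<gamma>(1) unfolding r_def by (simp add: mult_mono)
      finally show ?thesis
        unfolding r_def .
    qed
    finally show "measure_pmf.prob (random_subset_pmf p (1 / sqrt (real p)))
          {A. \<not> has_ap_mod p (sumset_mod p A) (k p)} \<le> g p"
      by (simp add: g_def M_def q_def)
  qed
  then have "((\<lambda>p. measure_pmf.prob (random_subset_pmf p (1 / sqrt (real p)))
        {A. \<not> has_ap_mod p (sumset_mod p A) (k p)}) \<longlongrightarrow> 0) (inf at_top (principal {p :: nat. prime p}))"
    by (rule tendsto_sandwich[OF always_eventually _ tendsto_const g, rotated]) simp
  then show "((\<lambda>p. measure_pmf.prob (random_subset_pmf p (1 / sqrt (real p)))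
            {A. \<not> has_ap_mod p (sumset_mod p A) (nat \<lceil>c * ln (real p)\<rceil>)}) \<longlongrightarrow> 0)
         (inf at_top (principal {p :: nat. prime p}))"
    by (simp only: k_def)
qed

theorem theorem1p8:
  "\<exists>c1 c2 :: real. c1 > 0 \<and> c2 > 0 \<and>
     ((\<lambda>p. measure_pmf.prob (random_subset_pmf p (1 / sqrt (real p)))
         {A. c1 * ln (real p) \<le> real (ap_mod p (sumset_mod p A)) \<and>
             real (ap_mod p (sumset_mod p A)) \<le> c2 * ln (real p)})
       \<longlongrightarrow> 1) (inf at_top (principal {p :: nat. prime p}))"
proof -
  define F where "F = inf at_top (principal {p :: nat. prime p})"
  define M where "M = (\<lambda>p :: nat. random_subset_pmf p (1 / sqrt (real p)))"
  define c1 where "c1 = 1 / (16 * - ln (1 - exp (- 1 / 100 :: real)))"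
  define c2 where "c2 = 192 / ln (3 / 2 :: real)"
  define G where "G = (\<lambda>p. {A. c1 * ln (real p) \<le> real (ap_mod p (sumset_mod p A)) \<and>
             real (ap_mod p (sumset_mod p A)) \<le> c2 * ln (real p)})"
  \<comment> \<open>The two lengths are the least integer above \<open>c2 * ln p\<close> and the
    least integer not below \<open>c1 * ln p\<close>, so excluding both events gives exactly the two
    inequalities.\<close>
  define long where "long = (\<lambda>p. {A. has_ap_mod p (sumset_mod p A) (nat \<lfloor>c2 * ln (real p)\<rfloor> + 1)})"
  define short where "short = (\<lambda>p. {A. \<not> has_ap_mod p (sumset_mod p A) (nat \<lceil>c1 * ln (real p)\<rceil>)})"
  have pos: "c1 > 0" "c2 > 0"
    using prob_no_ap_tendsto_0(1) by (simp_all add: c1_def c2_def)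
  have lim: "((\<lambda>p. measure_pmf.prob (M p) (long p)) \<longlongrightarrow> 0) F"
    "((\<lambda>p. measure_pmf.prob (M p) (short p)) \<longlongrightarrow> 0) F"
    using prob_long_ap_tendsto_0 prob_no_ap_tendsto_0(2)
    by (simp_all only: M_def F_def long_def short_def c1_def c2_def)
  have ge: "eventually (\<lambda>p. 1 - (measure_pmf.prob (M p) (long p) + measure_pmf.prob (M p) (short p))
          \<le> measure_pmf.prob (M p) (G p)) F"
    unfolding F_def eventually_inf_principal
  proof (intro always_eventually allI impI)
    fix p :: nat assume "p \<in> {p. prime p}"
    then have p: "p \<ge> 2"
      by (simp add: prime_ge_2_nat)
    have "- G p \<subseteq> long p \<union> short p"
    proof
      fix A assume A: "A \<in> - G p"
      show "A \<in> long p \<union> short p"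
      proof (rule ccontr)
        assume "\<not> ?thesis"
        then have "ap_mod p (sumset_mod p A) < nat \<lfloor>c2 * ln (real p)\<rfloor> + 1"
          "nat \<lceil>c1 * ln (real p)\<rceil> \<le> ap_mod p (sumset_mod p A)"
          using ap_mod_less[OF _ p] ap_mod_ge unfolding long_def short_def by blast+
        \<comment> \<open>Nonnegativity ensures that \<open>nat\<close> does not raise the floor
          above \<open>c2 * ln p\<close>.\<close>
        moreover have "0 \<le> c2 * ln (real p)"
          using pos(2) p by simp
        ultimately have "A \<in> G p"
          unfolding G_def by (simp, linarith)
        then show False
          using A by simp
      qed
    qed
    then have "measure_pmf.prob (M p) (- G p) \<le> measure_pmf.prob (M p) (long p \<union> short p)"
      by (intro measure_pmf.finite_measure_mono) auto
    also have "\<dots> \<le> measure_pmf.prob (M p) (long p) + measure_pmf.prob (M p) (short p)"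
      by (rule measure_subadditive) auto
    finally show "1 - (measure_pmf.prob (M p) (long p) + measure_pmf.prob (M p) (short p))
          \<le> measure_pmf.prob (M p) (G p)"
      using measure_pmf.prob_compl[of "G p" "M p"] by (simp add: Compl_eq_Diff_UNIV)
  qed
  have "((\<lambda>p. 1 - (measure_pmf.prob (M p) (long p) + measure_pmf.prob (M p) (short p))) \<longlongrightarrow> 1) F"
    using tendsto_diff[OF tendsto_const[of 1] tendsto_add[OF lim]] by simp
  then have "((\<lambda>p. measure_pmf.prob (M p) (G p)) \<longlongrightarrow> 1) F"
    by (rule tendsto_sandwich[OF ge always_eventually _ tendsto_const, rotated]) simp
  then show ?thesis
    unfolding M_def G_def F_def using pos by (intro exI[of _ c1] exI[of _ c2] conjI)
qed

end
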